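(* Let $F$ be a forest. Then $\mathsf{TS}_2(F)$ is acyclic if and only if $F$ is $\{2K_2, D_{2,2,2}\}$-free.
   Context: Graphs are finite, simple and undirected. For a graph $G$ and an integer $k\ge 2$, $\mathsf{TS}_k(G)$ is the graph whose nodes are all size-$k$ independent sets of $G$, two nodes $I,J$ being adjacent if there are vertices $u,v$ of $G$ with $I\setminus J=\{u\}$, $J\setminus I=\{v\}$ and $uv\in E(G)$. (A graph with no nodes counts as acyclic.) $2K_2$ is the disjoint union of two copies of $K_2$. For integers $n,r,s\ge 1$, $D_{r,n,s}$ is the tree obtained from the path $P_n$ on $n$ vertices by attaching $r$ leaves to one end vertex and $s$ leaves to the other end vertex. A graph is $\mathcal{F}$-free if it contains no member of $\mathcal{F}$ as an induced subgraph (up to isomorphism). *)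

theory Defs
  imports "Graph_Theory.Graph_Theory"
begin

text \<open>
  Finite simple undirected graphs are symmetric loop-free digraphs whose arcs are pairs of vertices
  (locale \<^locale>\<open>pair_graph\<close>; the null graph is allowed). An edge \<open>uv\<close> is the pair of arcs
  \<open>(u,v)\<close>, \<open>(v,u)\<close>.
\<close>

text \<open>
  The library's \<^const>\<open>forest\<close> is the digraph notion, under which a closed walk \<open>u,v,u\<close> along a single
  edge is a cycle. A cycle of an undirected graph has length at least 3; the library's
  \<^const>\<open>pre_digraph.cycle\<close> provides distinctness of the vertices.
\<close>

definition acyclic_graph :: "'a pair_pre_digraph \<Rightarrow> bool" where
  "acyclic_graph G \<longleftrightarrow> \<not> (\<exists>p. pre_digraph.cycle (with_proj G) p \<and> 3 \<le> length p)"

definition forest_graph :: "'a pair_pre_digraph \<Rightarrow> bool" where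
  "forest_graph G \<longleftrightarrow> pair_graph G \<and> acyclic_graph G"

definition independent_set :: "'a pair_pre_digraph \<Rightarrow> 'a set \<Rightarrow> bool" where
  "independent_set G I \<longleftrightarrow> I \<subseteq> pverts G \<and> (\<forall>u\<in>I. \<forall>v\<in>I. (u, v) \<notin> parcs G)"

definition TS :: "nat \<Rightarrow> 'a pair_pre_digraph \<Rightarrow> 'a set pair_pre_digraph" where
  "TS k G = (let V = {I. independent_set G I \<and> card I = k} in
     \<lparr> pverts = V,
       parcs = {(I, J). I \<in> V \<and> J \<in> V \<and>
         (\<exists>u v. I - J = {u} \<and> J - I = {v} \<and> (u, v) \<in> parcs G)} \<rparr>)"

definition two_K2 :: "nat pair_pre_digraph" where
  "two_K2 = \<lparr> pverts = {0, 1, 2, 3}, parcs = {(0, 1), (1, 0), (2, 3), (3, 2)} \<rparr>"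

text \<open>
  Meant for \<open>r, n, s \<ge> 1\<close>. The path is \<open>0, \<dots>, n - 1\<close> (its two ends coincide if \<open>n = 1\<close>), the leaves at
  \<open>0\<close> are \<open>n, \<dots>, n + r - 1\<close>, and the leaves at \<open>n - 1\<close> are \<open>n + r, \<dots>, n + r + s - 1\<close>.
\<close>

definition D_graph :: "nat \<Rightarrow> nat \<Rightarrow> nat \<Rightarrow> nat pair_pre_digraph" where
  "D_graph r n s = (let E = {(i, Suc i) | i. Suc i < n} \<union> {0} \<times> {n..<n + r}
                              \<union> {n - 1} \<times> {n + r..<n + r + s}
     in \<lparr> pverts = {..<n + r + s}, parcs = E \<union> E\<inverse> \<rparr>)"

definition induced_free :: "'b pair_pre_digraph set \<Rightarrow> 'a pair_pre_digraph \<Rightarrow> bool" where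
  "induced_free \<F> G \<longleftrightarrow>
     \<not> (\<exists>H\<in>\<F>. \<exists>S. induced_subgraph S (with_proj G) \<and> digraph_iso S (with_proj H))"

lemma pair_graphI:
  assumes "finite (pverts G)" "parcs G \<subseteq> pverts G \<times> pverts G" "sym (parcs G)" "irrefl (parcs G)"
  shows "pair_graph G"
proof -
  have "finite (parcs G)"
    using assms(1,2) by (meson finite_SigmaI finite_subset)
  with assms show ?thesis
    by unfold_locales (auto simp: symmetric_def irrefl_def)
qed

lemma pair_graph_TS:
  assumes "pair_graph G"
  shows "pair_graph (TS k G)"
proof (rule pair_graphI)
  have "symmetric (with_proj G)" and fin: "finite (pverts G)"
    using assms by (simp_all add: pair_graph_def pair_pseudo_graph_def pair_sym_digraph_def
        pair_sym_digraph_axioms_def pair_fin_digraph_def pair_fin_digraph_axioms_def)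
  then have S: "(u, v) \<in> parcs G \<Longrightarrow> (v, u) \<in> parcs G" for u v
    by (simp add: symmetric_def sym_def)
  have "pverts (TS k G) \<subseteq> Pow (pverts G)"
    by (auto simp: TS_def independent_set_def)
  then show "finite (pverts (TS k G))"
    using fin by (meson finite_Pow_iff finite_subset)
  show "parcs (TS k G) \<subseteq> pverts (TS k G) \<times> pverts (TS k G)"
    by (auto simp: TS_def)
  show "sym (parcs (TS k G))"
    unfolding sym_def TS_def Let_def by simp (blast intro: S)
  show "irrefl (parcs (TS k G))"
    by (simp add: TS_def irrefl_def Let_def)
qed

lemma pair_graph_two_K2: "pair_graph two_K2"
  by (rule pair_graphI) (auto simp: two_K2_def irrefl_def sym_def)

lemma pair_graph_D_graph:
  assumes "1 \<le> n"
  shows "pair_graph (D_graph r n s)"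
proof (rule pair_graphI)
  show "parcs (D_graph r n s) \<subseteq> pverts (D_graph r n s) \<times> pverts (D_graph r n s)"
    using assms by (auto simp: D_graph_def Let_def)
  show "sym (parcs (D_graph r n s))"
    by (auto simp: D_graph_def Let_def sym_Un_converse)
  show "irrefl (parcs (D_graph r n s))"
    using assms by (auto simp: D_graph_def Let_def irrefl_def)
qed (simp add: D_graph_def Let_def)

end

theory Submission
  imports Defs
begin

text \<open>
  An induced \<open>2K\<^sub>2\<close> with edges \<open>pq\<close> and \<open>rs\<close> gives the 4-cycle of \<open>TS\<^sub>2\<close> in which the two tokens move
  independently along these edges. In an induced \<open>D\<^sub>2\<^sub>,\<^sub>2\<^sub>,\<^sub>2\<close> with centres \<open>a\<close>, \<open>b\<close> the four sets
  consisting of a leaf at \<open>a\<close> and a leaf at \<open>b\<close> lie on an 8-cycle, consecutive ones being joined by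
  moving a token from one leaf through its centre to the other leaf.

  Conversely, a free forest has a vertex \<open>a\<close> that is incident to all edges except possibly one
  edge \<open>by\<close>, where \<open>b\<close> is a neighbour of \<open>a\<close>. A cycle of \<open>TS\<^sub>2\<close> would give a nonempty set \<open>W\<close> of nodes
  with two neighbours in \<open>W\<close> each. A node without \<open>a\<close> has at most one move to \<open>a\<close> and at most one
  along \<open>by\<close>; if such a node is in \<open>W\<close> then \<open>{b, q}\<close> and \<open>{y, q}\<close> are both in \<open>W\<close> and both have a move
  to \<open>a\<close>, so that \<open>q\<close> is neither adjacent nor non-adjacent to \<open>a\<close>. So all nodes in \<open>W\<close> contain \<open>a\<close>, and
  the only remaining edge \<open>by\<close> cannot be used because \<open>b\<close> is adjacent to \<open>a\<close>.
\<close>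

section \<open>Cycles as cyclic lists of vertices\<close>

lemma pcas_iff:
  "p \<noteq> [] \<Longrightarrow> pcas u p v \<longleftrightarrow>
     fst (hd p) = u \<and> snd (last p) = v \<and> successively (\<lambda>e f. snd e = fst f) p"
proof (induction p arbitrary: u)
  case (Cons e p)
  show ?case
  proof (cases "p = []")
    case False
    with Cons.IH[of "snd e"] show ?thesis by (auto simp: successively_Cons)
  qed auto
qed simp

text \<open>A library cycle is a list of arcs. Its heads form the list of vertices, and a list of
  vertices gives back arcs by pairing it with its rotation. The index modulo the length treats the
  closing arc like the others.\<close>

lemma acyclic_graph_iff:
  assumes "pair_wf_digraph G"
  shows "acyclic_graph G \<longleftrightarrow> \<not> (\<exists>xs. 3 \<le> length xs \<and> distinct xs \<and>
           (\<forall>i<length xs. (xs ! i, xs ! (Suc i mod length xs)) \<in> parcs G))"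
proof -
  interpret pair_wf_digraph G by fact
  have "\<exists>xs. 3 \<le> length xs \<and> distinct xs \<and>
          (\<forall>i<length xs. (xs ! i, xs ! (Suc i mod length xs)) \<in> parcs G)"
    if "cycle p" "3 \<le> length p" for p
  proof -
    from that obtain u where p: "set p \<subseteq> parcs G" "pcas u p u" "p \<noteq> []"
      and d: "distinct (tl (pawalk_verts u p))"
      by (auto simp: cycle_def awalk_def)
    \<comment> \<open>The start of the walk occurs again at its end; the tail of the vertex list is
      the list of heads, which counts it once.\<close>
    have d: "distinct (map snd p)"
      using awalk_verts_conv'[OF p(2)] p(3) d by simp
    have s: "fst (hd p) = snd (last p)" "successively (\<lambda>e f. snd e = fst f) p"
      using p pcas_iff by metis+
    let ?n = "length p"
    have "(map snd p ! i, map snd p ! (Suc i mod ?n)) \<in> parcs G" if i: "i < ?n" for i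
    proof -
      have "snd (p ! i) = fst (p ! (Suc i mod ?n))"
      proof (cases "Suc i = ?n")
        case True
        then show ?thesis using s(1) p(3) by (simp add: last_conv_nth hd_conv_nth flip: True)
      next
        case False
        then show ?thesis using s(2) i by (simp add: successively_conv_nth)
      qed
      moreover have j: "Suc i mod ?n < ?n" using i by (intro mod_less_divisor) linarith
      then have "p ! (Suc i mod ?n) \<in> parcs G" using p(1) nth_mem by blast
      ultimately show ?thesis using i j by simp
    qed
    with d that(2) show ?thesis by (intro exI[of _ "map snd p"]) simp
  qed
  moreover have "\<exists>p. cycle p \<and> 3 \<le> length p"
    if xs: "3 \<le> length xs" "distinct xs"
      "\<And>i. i < length xs \<Longrightarrow> (xs ! i, xs ! (Suc i mod length xs)) \<in> parcs G" for xs
  proof -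
    \<comment> \<open>The rotation lists the cyclic successors of the vertices.\<close>
    let ?p = "zip xs (rotate1 xs)"
    have ne: "?p \<noteq> []" "xs \<noteq> []" using xs(1) by (cases xs; auto)+
    have arcs: "set ?p \<subseteq> parcs G"
      using xs(3) by (auto simp: in_set_zip nth_rotate1)
    have cas: "pcas (hd xs) ?p (hd xs)"
      unfolding pcas_iff[OF ne(1)] using ne(2) xs(1)
      by (auto simp: successively_conv_nth nth_rotate1 hd_conv_nth last_conv_nth)
    have "distinct (tl (pawalk_verts (hd xs) ?p))"
      using awalk_verts_conv'[OF cas] ne xs(2) by simp
    moreover have "hd xs \<in> pverts G"
      using xs(3)[of 0] ne by (auto simp: hd_conv_nth dest: in_arcsD1)
    ultimately have "cycle ?p"
      using arcs cas ne(1) by (auto simp: cycle_def awalk_def)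
    with xs(1) show ?thesis by (intro exI[of _ ?p]) simp
  qed
  ultimately show ?thesis unfolding acyclic_graph_def by blast
qed

text \<open>A form for explicit cycles: on a concrete list \<open>successively\<close> unfolds to
  the single arcs, and only the closing arc is stated apart.\<close>

lemma not_acyclic_graphI:
  assumes "pair_wf_digraph G" "3 \<le> length xs" "distinct xs"
    and arcs: "successively (\<lambda>u v. (u, v) \<in> parcs G) xs" "(last xs, hd xs) \<in> parcs G"
  shows "\<not> acyclic_graph G"
proof -
  have ne: "xs \<noteq> []" using assms(2) by auto
  have "(xs ! i, xs ! (Suc i mod length xs)) \<in> parcs G" if i: "i < length xs" for i
  proof (cases "Suc i = length xs")
    case True
    then show ?thesis using arcs(2) ne by (simp add: last_conv_nth hd_conv_nth flip: True)
  next
    case False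
    then show ?thesis using arcs(1) i by (simp add: successively_conv_nth)
  qed
  then show ?thesis using acyclic_graph_iff[OF assms(1)] assms(2,3) by blast
qed

text \<open>\<open>W\<close> consists of the vertices of a cycle, and each has its cyclic
  predecessor and successor as neighbours.\<close>

lemma not_acyclic_graph_two_neighbours:
  assumes "pair_graph G" "\<not> acyclic_graph G"
  obtains W where "W \<noteq> {}" "W \<subseteq> pverts G"
    "\<And>v. v \<in> W \<Longrightarrow> \<exists>x\<in>W. \<exists>y\<in>W. x \<noteq> y \<and> (v, x) \<in> parcs G \<and> (v, y) \<in> parcs G"
proof -
  interpret pair_graph G by fact
  obtain xs where xs: "3 \<le> length xs" "distinct xs"
      "\<And>i. i < length xs \<Longrightarrow> (xs ! i, xs ! (Suc i mod length xs)) \<in> parcs G"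
    using assms acyclic_graph_iff pair_wf_digraph by blast
  let ?n = "length xs"
  show thesis
  proof
    show "set xs \<noteq> {}" using xs(1) by auto
    show "set xs \<subseteq> pverts G"
      using xs(3) by (metis in_arcsD1 in_set_conv_nth subsetI)
    fix v assume "v \<in> set xs"
    then obtain i where i: "i < ?n" "v = xs ! i" by (auto simp: in_set_conv_nth)
    \<comment> \<open>The cyclic predecessor of \<open>i\<close>; truncated subtraction would not
      wrap around at 0.\<close>
    define j where "j = (if i = 0 then ?n - 1 else i - 1)"
    have j: "j < ?n" "Suc j mod ?n = i" using i xs(1) by (auto simp: j_def)
    have k: "Suc i mod ?n < ?n" using i by (intro mod_less_divisor) linarith
    \<comment> \<open>On a cyclic list of two entries predecessor and successor would coincide;
      length at least 3 separates them.\<close>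
    have "j \<noteq> Suc i mod ?n"
      using i xs(1) by (cases "Suc i = ?n") (auto simp: j_def)
    then have "xs ! j \<noteq> xs ! (Suc i mod ?n)" using xs(2) j k by (simp add: nth_eq_iff_index_eq)
    moreover have "(v, xs ! j) \<in> parcs G" using xs(3)[OF j(1)] j(2) i arcs_symmetric by simp
    moreover have "(v, xs ! (Suc i mod ?n)) \<in> parcs G" using xs(3) i by simp
    ultimately show "\<exists>x\<in>set xs. \<exists>y\<in>set xs. x \<noteq> y \<and> (v, x) \<in> parcs G \<and> (v, y) \<in> parcs G"
      using j k nth_mem by metis
  qed
qed

section \<open>Induced copies as patterns of arcs and non-arcs\<close>

text \<open>Library isomorphisms carry separate maps for vertices and arcs. As arcs here are pairs,
  the arc map is forced by the vertex map \<open>f\<close>, so an embedding that preserves and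
  reflects arcs is the same information.\<close>

lemma induced_copy_iff:
  assumes "pair_wf_digraph G" "pair_wf_digraph H"
  shows "(\<exists>S. induced_subgraph S (with_proj G) \<and> digraph_iso S (with_proj H)) \<longleftrightarrow>
         (\<exists>f. inj_on f (pverts H) \<and> f ` pverts H \<subseteq> pverts G \<and>
            (\<forall>x\<in>pverts H. \<forall>y\<in>pverts H. (x, y) \<in> parcs H \<longleftrightarrow> (f x, f y) \<in> parcs G))"
    (is "?L \<longleftrightarrow> ?R")
proof
  interpret G: pair_wf_digraph G by fact
  interpret H: pair_wf_digraph H by fact
  have wf: "wf_digraph (with_proj G)" "wf_digraph (with_proj H)"
    using assms by (simp_all add: wf_digraph_wp_iff)
  {
    assume ?L
    then obtain S where S: "induced_subgraph S (with_proj G)" "digraph_iso S (with_proj H)" by blast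
    have sub: "verts S \<subseteq> pverts G" "wf_digraph S" and tS: "tail S = fst" "head S = snd"
      and aS: "arcs S = {e \<in> parcs G. fst e \<in> verts S \<and> snd e \<in> verts S}"
      using S(1) unfolding induced_subgraph_def subgraph_def compatible_def by auto
    \<comment> \<open>The isomorphism is reversed so that its vertex map starts in
      \<open>H\<close>.\<close>
    obtain h where h: "pre_digraph.digraph_isomorphism (with_proj H) h"
        and S_eq: "S = app_iso h (with_proj H)"
      using digraph_iso_swap[OF sub(2) S(2)] unfolding digraph_iso_def by blast
    define f where "f = iso_verts h"
    have inj: "inj_on f (pverts H)"
      using h by (simp add: pre_digraph.digraph_isomorphism_def f_def)
    have vS: "verts S = f ` pverts H" by (simp add: S_eq f_def)
    have "iso_arcs h e = map_prod f f e" if "e \<in> parcs H" for e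
      using h that tS unfolding pre_digraph.digraph_isomorphism_def S_eq
      by (simp add: f_def prod_eq_iff)
    then have aS': "arcs S = map_prod f f ` parcs H" by (simp add: S_eq)
    have "(x, y) \<in> parcs H \<longleftrightarrow> (f x, f y) \<in> parcs G"
      if xy: "x \<in> pverts H" "y \<in> pverts H" for x y
    proof -
      have "(f x, f y) \<in> parcs G \<longleftrightarrow> (f x, f y) \<in> map_prod f f ` parcs H"
        using xy by (simp add: vS flip: aS') (simp add: aS vS)
      also have "\<dots> \<longleftrightarrow> (x, y) \<in> parcs H"
      proof
        assume "(f x, f y) \<in> map_prod f f ` parcs H"
        then obtain u v where "(u, v) \<in> parcs H" "f x = f u" "f y = f v" by auto
        moreover then have "u \<in> pverts H" "v \<in> pverts H" by (auto dest: H.wellformed')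
        ultimately show "(x, y) \<in> parcs H" using inj xy by (metis inj_onD)
      qed force
      finally show ?thesis by simp
    qed
    with inj vS sub(1) show ?R by (intro exI[of _ f]) auto
  next
    assume ?R
    then obtain f where inj: "inj_on f (pverts H)" and im: "f ` pverts H \<subseteq> pverts G"
      and f: "\<And>x y. x \<in> pverts H \<Longrightarrow> y \<in> pverts H \<Longrightarrow> (x, y) \<in> parcs H \<longleftrightarrow> (f x, f y) \<in> parcs G"
      by blast
    have sub: "parcs H \<subseteq> pverts H \<times> pverts H" by (auto dest: H.wellformed')
    define h where "h = \<lparr>iso_verts = f, iso_arcs = map_prod f f, iso_head = snd, iso_tail = fst\<rparr>"
    have h: "pre_digraph.digraph_isomorphism (with_proj H) h"
      unfolding pre_digraph.digraph_isomorphism_def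
      using wf(2) inj inj_on_subset[OF map_prod_inj_on[OF inj inj] sub] by (simp add: h_def)
    define S where "S = app_iso h (with_proj H)"
    have "wf_digraph S"
      unfolding S_def using wf(2) h by (rule wf_digraph.wf_digraphI_app_iso)
    have arcs: "map_prod f f ` parcs H = {e \<in> parcs G. fst e \<in> f ` pverts H \<and> snd e \<in> f ` pverts H}"
    proof (intro equalityI subsetI)
      fix e assume "e \<in> map_prod f f ` parcs H"
      then obtain x y where xy: "(x, y) \<in> parcs H" "e = (f x, f y)" by auto
      then have "x \<in> pverts H" "y \<in> pverts H" by (auto dest: H.wellformed')
      with xy f show "e \<in> {e \<in> parcs G. fst e \<in> f ` pverts H \<and> snd e \<in> f ` pverts H}" by auto
    next
      fix e assume "e \<in> {e \<in> parcs G. fst e \<in> f ` pverts H \<and> snd e \<in> f ` pverts H}"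
      then obtain x y where "x \<in> pverts H" "y \<in> pverts H" "e = (f x, f y)" "e \<in> parcs G"
        by (cases e) auto
      with f show "e \<in> map_prod f f ` parcs H" by force
    qed
    have "digraph_iso (with_proj H) S" using h S_def by (auto simp: digraph_iso_def)
    then have "digraph_iso S (with_proj H)" using wf(2) by (rule digraph_iso_swap[rotated])
    moreover have "induced_subgraph S (with_proj G)"
      unfolding induced_subgraph_def subgraph_def compatible_def
      using wf(1) \<open>wf_digraph S\<close> im arcs by (auto simp: S_def h_def)
    ultimately show ?L by blast
  }
qed

text \<open>Distinctness comes from the pattern itself: identifying an end of one edge with an end
  of the other would turn one of the non-arcs into an arc.\<close>

lemma two_K2_copy_iff:
  assumes "pair_graph G"
  shows "(\<exists>S. induced_subgraph S (with_proj G) \<and> digraph_iso S (with_proj two_K2)) \<longleftrightarrow>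
         (\<exists>p q r s. (p, q) \<in> parcs G \<and> (r, s) \<in> parcs G \<and>
            (p, r) \<notin> parcs G \<and> (p, s) \<notin> parcs G \<and> (q, r) \<notin> parcs G \<and> (q, s) \<notin> parcs G)"
    (is "?L \<longleftrightarrow> ?R")
proof -
  interpret pair_graph G by fact
  interpret H: pair_graph two_K2 by (rule pair_graph_two_K2)
  note copy = induced_copy_iff[OF pair_wf_digraph H.pair_wf_digraph]
  show ?thesis unfolding copy
  proof safe
    fix f :: "nat \<Rightarrow> 'a"
    assume "\<forall>x\<in>pverts two_K2. \<forall>y\<in>pverts two_K2. (x, y) \<in> parcs two_K2 \<longleftrightarrow> (f x, f y) \<in> parcs G"
    then show ?R
      by (intro exI[of _ "f 0"] exI[of _ "f 1"] exI[of _ "f 2"] exI[of _ "f 3"]) (simp add: two_K2_def)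
  next
    fix p q r s
    assume e: "(p, q) \<in> parcs G" "(r, s) \<in> parcs G"
      and n: "(p, r) \<notin> parcs G" "(p, s) \<notin> parcs G" "(q, r) \<notin> parcs G" "(q, s) \<notin> parcs G"
    have sym: "(u, v) \<in> parcs G \<longleftrightarrow> (v, u) \<in> parcs G" for u v using arcs_symmetric by blast
    have d: "p \<noteq> q" "r \<noteq> s" "p \<noteq> r" "p \<noteq> s" "q \<noteq> r" "q \<noteq> s"
      using e n sym no_loops' by blast+
    have e': "(q, p) \<in> parcs G" "(s, r) \<in> parcs G"
      and n': "(r, p) \<notin> parcs G" "(s, p) \<notin> parcs G" "(r, q) \<notin> parcs G" "(s, q) \<notin> parcs G"
      using e n sym by blast+
    have l: "(u, u) \<notin> parcs G" for u using no_loops' by blast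
    have v: "{p, q, r, s} \<subseteq> pverts G" using e by (auto dest: wellformed')
    show "\<exists>f. inj_on f (pverts two_K2) \<and> f ` pverts two_K2 \<subseteq> pverts G \<and>
        (\<forall>x\<in>pverts two_K2. \<forall>y\<in>pverts two_K2. (x, y) \<in> parcs two_K2 \<longleftrightarrow> (f x, f y) \<in> parcs G)"
      using d e n e' n' l v by (intro exI[of _ "\<lambda>i. [p, q, r, s] ! i"]) (simp add: two_K2_def)
  qed
qed

lemma D_graph_2_2_2:
  "pverts (D_graph 2 2 2) = {0, 1, 2, 3, 4, 5}"
  "parcs (D_graph 2 2 2) = {(0, 1), (0, 2), (0, 3), (1, 4), (1, 5), (1, 0), (2, 0), (3, 0), (4, 1), (5, 1)}"
proof -
  have sets: "{..<6::nat} = {0, 1, 2, 3, 4, 5}" "{2..<4::nat} = {2, 3}" "{4..<6::nat} = {4, 5}"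
    by (simp_all add: numeral_eq_Suc lessThan_Suc atLeastLessThanSuc insert_commute)
  have path: "{(i, Suc i) | i. Suc i < 2} = {(0, 1)}" by auto
  have conv: "(insert p R)\<inverse> = insert (prod.swap p) (R\<inverse>)" for p :: "nat \<times> nat" and R
    by (cases p) auto
  show "pverts (D_graph 2 2 2) = {0, 1, 2, 3, 4, 5}"
    using sets by (simp add: D_graph_def Let_def)
  show "parcs (D_graph 2 2 2) = {(0, 1), (0, 2), (0, 3), (1, 4), (1, 5), (1, 0), (2, 0), (3, 0), (4, 1), (5, 1)}"
    unfolding D_graph_def Let_def path by (simp add: sets conv insert_commute)
qed

text \<open>\<open>a\<close> and \<open>b\<close> are the centres 0 and 1, followed by the leaves 2,
  3 at \<open>a\<close> and 4, 5 at \<open>b\<close>. Distinctness is part of the pattern, since two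
  leaves at the same centre have the same neighbours and arcs cannot tell them apart.\<close>

lemma D_graph_2_2_2_copy_iff:
  assumes "pair_graph G"
  shows "(\<exists>S. induced_subgraph S (with_proj G) \<and> digraph_iso S (with_proj (D_graph 2 2 2))) \<longleftrightarrow>
         (\<exists>a b x x' y y'. distinct [a, b, x, x', y, y'] \<and>
            (a, b) \<in> parcs G \<and> (a, x) \<in> parcs G \<and> (a, x') \<in> parcs G \<and> (b, y) \<in> parcs G \<and> (b, y') \<in> parcs G \<and>
            (a, y) \<notin> parcs G \<and> (a, y') \<notin> parcs G \<and> (b, x) \<notin> parcs G \<and> (b, x') \<notin> parcs G \<and>
            (x, x') \<notin> parcs G \<and> (y, y') \<notin> parcs G \<and>
            (x, y) \<notin> parcs G \<and> (x, y') \<notin> parcs G \<and> (x', y) \<notin> parcs G \<and> (x', y') \<notin> parcs G)"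
    (is "?L \<longleftrightarrow> ?R")
proof -
  interpret pair_graph G by fact
  interpret H: pair_graph "D_graph 2 2 2" by (rule pair_graph_D_graph) simp
  note copy = induced_copy_iff[OF pair_wf_digraph H.pair_wf_digraph]
  let ?V = "pverts (D_graph 2 2 2)" and ?E = "parcs (D_graph 2 2 2)"
  show ?thesis unfolding copy
  proof (intro iffI; elim exE conjE)
    fix f :: "nat \<Rightarrow> 'a"
    assume inj: "inj_on f ?V" and "\<forall>x\<in>?V. \<forall>y\<in>?V. (x, y) \<in> ?E \<longleftrightarrow> (f x, f y) \<in> parcs G"
    then have f: "(f x, f y) \<in> parcs G \<longleftrightarrow> (x, y) \<in> ?E" if "x \<in> ?V" "y \<in> ?V" for x y
      using that by blast
    have "distinct (map f [0, 1, 2, 3, 4, 5])"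
      unfolding distinct_map using inj by (simp add: D_graph_2_2_2)
    then have "distinct [f 0, f 1, f 2, f 3, f 4, f 5]" by (simp only: list.map)
    then show ?R
      by (intro exI[of _ "f 0"] exI[of _ "f 1"] exI[of _ "f 2"] exI[of _ "f 3"]
          exI[of _ "f 4"] exI[of _ "f 5"] conjI) (assumption | simp add: f D_graph_2_2_2)+
  next
    fix a b x x' y y'
    assume d: "distinct [a, b, x, x', y, y']"
      and e: "(a, b) \<in> parcs G" "(a, x) \<in> parcs G" "(a, x') \<in> parcs G" "(b, y) \<in> parcs G" "(b, y') \<in> parcs G"
      and n: "(a, y) \<notin> parcs G" "(a, y') \<notin> parcs G" "(b, x) \<notin> parcs G" "(b, x') \<notin> parcs G"
        "(x, x') \<notin> parcs G" "(y, y') \<notin> parcs G"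
        "(x, y) \<notin> parcs G" "(x, y') \<notin> parcs G" "(x', y) \<notin> parcs G" "(x', y') \<notin> parcs G"
    have e': "(b, a) \<in> parcs G" "(x, a) \<in> parcs G" "(x', a) \<in> parcs G" "(y, b) \<in> parcs G" "(y', b) \<in> parcs G"
      using e arcs_symmetric by blast+
    have n': "(y, a) \<notin> parcs G" "(y', a) \<notin> parcs G" "(x, b) \<notin> parcs G" "(x', b) \<notin> parcs G"
        "(x', x) \<notin> parcs G" "(y', y) \<notin> parcs G"
        "(y, x) \<notin> parcs G" "(y', x) \<notin> parcs G" "(y, x') \<notin> parcs G" "(y', x') \<notin> parcs G"
      using n arcs_symmetric by blast+
    have l: "(u, u) \<notin> parcs G" for u using no_loops' by blast
    have v: "{a, b, x, x', y, y'} \<subseteq> pverts G" using e by (auto dest: wellformed')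
    let ?f = "(!) [a, b, x, x', y, y']"
    have "inj_on ?f ?V" using d by (intro inj_on_nth) (simp_all add: D_graph_2_2_2)
    moreover have "?f ` ?V \<subseteq> pverts G" using v by (simp add: D_graph_2_2_2)
    moreover have "\<forall>x\<in>?V. \<forall>y\<in>?V. (x, y) \<in> ?E \<longleftrightarrow> (?f x, ?f y) \<in> parcs G"
      using e n e' n' l by (simp add: D_graph_2_2_2)
    ultimately show "\<exists>f. inj_on f ?V \<and> f ` ?V \<subseteq> pverts G \<and>
        (\<forall>x\<in>?V. \<forall>y\<in>?V. (x, y) \<in> ?E \<longleftrightarrow> (f x, f y) \<in> parcs G)"
      by blast
  qed
qed

section \<open>Token moves and explicit cycles in \<open>TS 2 G\<close>\<close>

text \<open>The token on \<open>z\<close> stays and the other moves from \<open>x\<close> to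
  \<open>y\<close>. The inequalities make both sets have two elements; non-adjacency alone allows
  equality, as there are no loops.\<close>

lemma TS_2_arc_iff:
  assumes "pair_graph G"
  shows "(I, J) \<in> parcs (TS 2 G) \<longleftrightarrow>
    (\<exists>x y z. I = {x, z} \<and> J = {y, z} \<and> z \<in> pverts G \<and> x \<noteq> z \<and> y \<noteq> z \<and>
       (x, y) \<in> parcs G \<and> (x, z) \<notin> parcs G \<and> (y, z) \<notin> parcs G)"
    (is "?L \<longleftrightarrow> ?R")
proof
  interpret pair_graph G by fact
  {
    assume ?L
    then obtain x y where I: "independent_set G I" "card I = 2" and J: "independent_set G J"
      and xy: "I - J = {x}" "J - I = {y}" "(x, y) \<in> parcs G"
      by (auto simp: TS_def Let_def)
    have "x \<in> I" using xy(1) by blast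
    then obtain z where z: "I = {x, z}" "x \<noteq> z"
      using I(2) by (metis card_2_iff insert_commute insertE singletonD)
    have "z \<notin> I - J" using xy(1) z(2) by simp
    then have "z \<in> J" using z(1) by simp
    then have "J = {y, z}" "y \<noteq> z" using xy z by auto
    moreover have "z \<in> pverts G" "(x, z) \<notin> parcs G" using I(1) z(1) by (auto simp: independent_set_def)
    moreover have "(y, z) \<notin> parcs G" using J \<open>J = {y, z}\<close> by (auto simp: independent_set_def)
    ultimately show ?R using z xy(3) by blast
  next
    assume ?R
    then obtain x y z where *: "I = {x, z}" "J = {y, z}" "z \<in> pverts G" "x \<noteq> z" "y \<noteq> z"
       "(x, y) \<in> parcs G" "(x, z) \<notin> parcs G" "(y, z) \<notin> parcs G" by blast
    moreover have "x \<noteq> y" using * no_loops' by blast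
    moreover have "(z, x) \<notin> parcs G" "(z, y) \<notin> parcs G" "(u, u) \<notin> parcs G" for u
      using * arcs_symmetric no_loops' by blast+
    moreover have "x \<in> pverts G" "y \<in> pverts G" using * by (auto dest: wellformed')
    ultimately show ?L
      unfolding TS_def Let_def independent_set_def by auto
  }
qed

context pair_graph
begin

text \<open>One move in both directions and both ways of writing the sets, so that the simplifier
  can match the arcs of a concrete cycle.\<close>

lemma TS_2_move:
  assumes "(u, v) \<in> parcs G" "w \<in> pverts G" "u \<noteq> w" "v \<noteq> w" "(u, w) \<notin> parcs G" "(v, w) \<notin> parcs G"
  shows "({u, w}, {v, w}) \<in> parcs (TS 2 G)" "({w, u}, {w, v}) \<in> parcs (TS 2 G)"
    "({v, w}, {u, w}) \<in> parcs (TS 2 G)" "({w, v}, {w, u}) \<in> parcs (TS 2 G)"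
proof -
  interpret T: pair_graph "TS 2 G" by (rule pair_graph_TS) (rule pair_graph)
  show *: "({u, w}, {v, w}) \<in> parcs (TS 2 G)"
    using assms by (auto simp: TS_2_arc_iff[OF pair_graph])
  then show "({v, w}, {u, w}) \<in> parcs (TS 2 G)" by (rule T.arcs_symmetric)
  with * show "({w, u}, {w, v}) \<in> parcs (TS 2 G)" "({w, v}, {w, u}) \<in> parcs (TS 2 G)"
    by (simp_all add: insert_commute)
qed

lemma not_acyclic_TS_2_if_two_K2:
  assumes "(p, q) \<in> parcs G" "(r, s) \<in> parcs G"
    "(p, r) \<notin> parcs G" "(p, s) \<notin> parcs G" "(q, r) \<notin> parcs G" "(q, s) \<notin> parcs G"
  shows "\<not> acyclic_graph (TS 2 G)"
proof -
  interpret T: pair_graph "TS 2 G" by (rule pair_graph_TS) (rule pair_graph)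
  have sym: "(u, v) \<in> parcs G \<longleftrightarrow> (v, u) \<in> parcs G" for u v using arcs_symmetric by blast
  have d: "p \<noteq> q" "r \<noteq> s" "p \<noteq> r" "p \<noteq> s" "q \<noteq> r" "q \<noteq> s"
    using assms sym no_loops' by blast+
  have v: "{p, q, r, s} \<subseteq> pverts G" using assms by (auto dest: wellformed')
  have n: "(r, p) \<notin> parcs G" "(s, p) \<notin> parcs G" "(r, q) \<notin> parcs G" "(s, q) \<notin> parcs G"
    using assms sym by blast+
  have "({p, r}, {q, r}) \<in> parcs (TS 2 G)" "({q, s}, {p, s}) \<in> parcs (TS 2 G)"
    "({q, r}, {q, s}) \<in> parcs (TS 2 G)" "({p, s}, {p, r}) \<in> parcs (TS 2 G)"
    using assms d v n by (simp_all add: TS_2_move)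
  moreover have "distinct [{p, r}, {q, r}, {q, s}, {p, s}]"
    using d by (simp add: doubleton_eq_iff)
  ultimately show ?thesis
    by (intro not_acyclic_graphI[OF T.pair_wf_digraph, of "[{p, r}, {q, r}, {q, s}, {p, s}]"]) simp_all
qed

text \<open>The tokens take turns: one passes through its centre to the other leaf while the other
  rests on a leaf. At most one centre is occupied at a time.\<close>

lemma not_acyclic_TS_2_if_double_star:
  assumes "distinct [a, b, x, x', y, y']"
    and "(a, x) \<in> parcs G" "(a, x') \<in> parcs G" "(b, y) \<in> parcs G" "(b, y') \<in> parcs G"
    and "(a, y) \<notin> parcs G" "(a, y') \<notin> parcs G" "(b, x) \<notin> parcs G" "(b, x') \<notin> parcs G"
      "(x, y) \<notin> parcs G" "(x, y') \<notin> parcs G" "(x', y) \<notin> parcs G" "(x', y') \<notin> parcs G"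
  shows "\<not> acyclic_graph (TS 2 G)"
proof -
  interpret T: pair_graph "TS 2 G" by (rule pair_graph_TS) (rule pair_graph)
  have v: "{a, b, x, x', y, y'} \<subseteq> pverts G" using assms by (auto dest: wellformed')
  have n: "(y, a) \<notin> parcs G" "(y', a) \<notin> parcs G" "(x, b) \<notin> parcs G" "(x', b) \<notin> parcs G"
      "(y, x) \<notin> parcs G" "(y', x) \<notin> parcs G" "(y, x') \<notin> parcs G" "(y', x') \<notin> parcs G"
    using assms arcs_symmetric by blast+
  have d: "y \<noteq> x" "y \<noteq> x'" "y' \<noteq> x" "y' \<noteq> x'" using assms(1) by auto
  have "({x, y}, {a, y}) \<in> parcs (TS 2 G)" "({a, y}, {x', y}) \<in> parcs (TS 2 G)"
    "({x', y}, {x', b}) \<in> parcs (TS 2 G)" "({x', b}, {x', y'}) \<in> parcs (TS 2 G)"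
    "({x', y'}, {a, y'}) \<in> parcs (TS 2 G)" "({a, y'}, {x, y'}) \<in> parcs (TS 2 G)"
    "({x, y'}, {x, b}) \<in> parcs (TS 2 G)" "({x, b}, {x, y}) \<in> parcs (TS 2 G)"
    using assms v n d by (simp_all add: TS_2_move)
  moreover have "distinct [{x, y}, {a, y}, {x', y}, {x', b}, {x', y'}, {a, y'}, {x, y'}, {x, b}]"
    using assms(1) by (auto simp: doubleton_eq_iff)
  ultimately show ?thesis
    by (intro not_acyclic_graphI[OF T.pair_wf_digraph, of "[{x, y}, {a, y}, {x', y}, {x', b}, {x', y'}, {a, y'}, {x, y'}, {x, b}]"]) simp_all
qed

section \<open>Acyclicity of \<open>TS 2 G\<close> when one vertex meets all edges but at most
  one\<close>

lemma acyclic_TS_2I: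
  assumes star: "\<And>u v. (u, v) \<in> parcs G \<Longrightarrow> u = a \<or> v = a \<or> {u, v} = {b, y}"
    and ab: "(b, y) \<in> parcs G \<Longrightarrow> (a, b) \<in> parcs G" and ay: "(a, y) \<notin> parcs G"
  shows "acyclic_graph (TS 2 G)"
proof (rule ccontr)
  assume "\<not> acyclic_graph (TS 2 G)"
  then obtain W where W: "W \<noteq> {}"
    and nbrs: "\<And>I. I \<in> W \<Longrightarrow> \<exists>J\<in>W. \<exists>K\<in>W. J \<noteq> K \<and> (I, J) \<in> parcs (TS 2 G) \<and> (I, K) \<in> parcs (TS 2 G)"
    using not_acyclic_graph_two_neighbours[OF pair_graph_TS[OF pair_graph]] by metis
  have sym: "(u, v) \<in> parcs G \<longleftrightarrow> (v, u) \<in> parcs G" for u v using arcs_symmetric by blast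
  \<comment> \<open>The moving element \<open>p\<close> is the one adjacent to \<open>a\<close>, so
    \<open>I\<close> determines the target of a move to \<open>a\<close>.\<close>
  have to_a: "\<exists>p q. I = {p, q} \<and> J = {a, q} \<and> (p, a) \<in> parcs G \<and> (q, a) \<notin> parcs G"
    if IJ: "(I, J) \<in> parcs (TS 2 G)" "a \<notin> I" "a \<in> J" for I J
  proof -
    obtain p v q where "I = {p, q}" "J = {v, q}" "(p, v) \<in> parcs G" "(v, q) \<notin> parcs G"
      using IJ(1) unfolding TS_2_arc_iff[OF pair_graph] by blast
    moreover then have "v = a" using IJ(2,3) by blast
    ultimately show ?thesis using sym by blast
  qed
  \<comment> \<open>Only the edge \<open>by\<close> avoids \<open>a\<close>. As \<open>q\<close>
    lies outside this edge, \<open>I\<close> contains exactly one of its ends and again determines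
    the target.\<close>
  have not_to_a: "\<exists>q. (b, y) \<in> parcs G \<and> q \<noteq> b \<and> q \<noteq> y \<and> a \<notin> {b, y, q} \<and>
        (I = {b, q} \<and> J = {y, q} \<or> I = {y, q} \<and> J = {b, q})"
    if IJ: "(I, J) \<in> parcs (TS 2 G)" "a \<notin> I" "a \<notin> J" for I J
  proof -
    obtain u v q where "I = {u, q}" "J = {v, q}" "u \<noteq> q" "v \<noteq> q" "(u, v) \<in> parcs G"
      using IJ(1) unfolding TS_2_arc_iff[OF pair_graph] by blast
    with star[of u v] IJ(2,3) show ?thesis
      by (intro exI[of _ q]) (auto simp: doubleton_eq_iff sym)
  qed
  \<comment> \<open>Each kind of move has at most one target, so the two distinct neighbours of
    \<open>I\<close> in \<open>W\<close> use one kind each.\<close>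
  have both: "(\<exists>p q. I = {p, q} \<and> (p, a) \<in> parcs G \<and> (q, a) \<notin> parcs G) \<and> (\<exists>J\<in>W. (I, J) \<in> parcs (TS 2 G) \<and> a \<notin> J)"
    if I: "I \<in> W" "a \<notin> I" for I
  proof -
    obtain J K where JK: "J \<in> W" "K \<in> W" "J \<noteq> K" "(I, J) \<in> parcs (TS 2 G)" "(I, K) \<in> parcs (TS 2 G)"
      using nbrs[OF I(1)] by blast
    have "\<not> (a \<in> J \<and> a \<in> K)"
    proof
      assume "a \<in> J \<and> a \<in> K"
      then obtain p q p' q' where "I = {p, q}" "J = {a, q}" "(p, a) \<in> parcs G" "(q, a) \<notin> parcs G"
        "I = {p', q'}" "K = {a, q'}" "(p', a) \<in> parcs G" "(q', a) \<notin> parcs G"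
        using to_a[OF JK(4) I(2)] to_a[OF JK(5) I(2)] by blast
      with JK(3) show False by (metis doubleton_eq_iff)
    qed
    moreover have "a \<in> J \<or> a \<in> K"
    proof (rule ccontr)
      assume "\<not> (a \<in> J \<or> a \<in> K)"
      then obtain q q' where "q \<noteq> b" "q \<noteq> y" "I = {b, q} \<and> J = {y, q} \<or> I = {y, q} \<and> J = {b, q}"
        "q' \<noteq> b" "q' \<noteq> y" "I = {b, q'} \<and> K = {y, q'} \<or> I = {y, q'} \<and> K = {b, q'}"
        using not_to_a[OF JK(4) I(2)] not_to_a[OF JK(5) I(2)] by blast
      with JK(3) show False by (metis doubleton_eq_iff)
    qed
    ultimately show ?thesis using JK to_a I(2) by metis
  qed
  have a_mem: "a \<in> I" if "I \<in> W" for I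
  proof (rule ccontr)
    assume "a \<notin> I"
    obtain J where J: "J \<in> W" "(I, J) \<in> parcs (TS 2 G)" "a \<notin> J"
      using both \<open>I \<in> W\<close> \<open>a \<notin> I\<close> by blast
    obtain q where q: "(b, y) \<in> parcs G" and IJ: "{I, J} = {{b, q}, {y, q}}"
      using not_to_a[OF J(2) \<open>a \<notin> I\<close> J(3)] by blast
    then have "{b, q} \<in> W" "{y, q} \<in> W" "a \<notin> {b, q}" "a \<notin> {y, q}"
      using J \<open>I \<in> W\<close> \<open>a \<notin> I\<close> by (auto simp: doubleton_eq_iff)
    then have "\<exists>u v. {b, q} = {u, v} \<and> (u, a) \<in> parcs G \<and> (v, a) \<notin> parcs G"
      "\<exists>u v. {y, q} = {u, v} \<and> (u, a) \<in> parcs G \<and> (v, a) \<notin> parcs G"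
      using both by blast+
    \<comment> \<open>Both sets have exactly one element adjacent to \<open>a\<close>. Since
      \<open>b\<close> is adjacent to \<open>a\<close> and \<open>y\<close> is not,
      \<open>{b, q}\<close> excludes and \<open>{y, q}\<close> requires that \<open>q\<close> is
      adjacent to \<open>a\<close>.\<close>
    then show False using ab[OF q] ay sym by (auto simp: doubleton_eq_iff)
  qed
  obtain I J where "I \<in> W" "J \<in> W" "(I, J) \<in> parcs (TS 2 G)" using W nbrs by blast
  moreover obtain u v z where "I = {u, z}" "J = {v, z}" and uv: "(u, v) \<in> parcs G"
      "(u, z) \<notin> parcs G" "(v, z) \<notin> parcs G" "u \<noteq> z" "v \<noteq> z"
    using calculation(3) unfolding TS_2_arc_iff[OF pair_graph] by blast
  moreover have "u \<noteq> v" using uv(1) no_loops' by blast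
  \<comment> \<open>Both nodes contain \<open>a\<close>, and \<open>u\<close>, \<open>v\<close>
    differ, so \<open>a\<close> is the resting token. The move is then along \<open>by\<close>, and
    one node would be the non-independent set \<open>{b, a}\<close>.\<close>
  ultimately have "z = a" using a_mem by blast
  then have "{u, v} = {b, y}" using star[OF uv(1)] uv(4,5) by blast
  then show False using uv ab \<open>z = a\<close> sym by (auto simp: doubleton_eq_iff)
qed

end

section \<open>Short cycles and the shape of free forests\<close>

context
  fixes F :: "'a pair_pre_digraph"
  assumes forest: "forest_graph F"
begin

interpretation pair_graph F using forest by (simp add: forest_graph_def)

lemma forest_closed_list:
  assumes "3 \<le> length xs" "distinct xs"
    "successively (\<lambda>u v. (u, v) \<in> parcs F) xs" "(last xs, hd xs) \<in> parcs F"
  shows False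
  using not_acyclic_graphI[OF pair_wf_digraph assms] forest unfolding forest_graph_def by blast

lemma forest_no_triangle:
  assumes "(a, b) \<in> parcs F" "(b, c) \<in> parcs F" "(c, a) \<in> parcs F"
  shows False
proof -
  have "a \<noteq> b" "b \<noteq> c" "c \<noteq> a" using assms no_loops' by blast+
  with assms show False
    by (intro forest_closed_list[of "[a, b, c]"]) auto
qed

lemma forest_no_square:
  assumes "(a, b) \<in> parcs F" "(b, c) \<in> parcs F" "(c, d) \<in> parcs F" "(d, a) \<in> parcs F"
    and "a \<noteq> c" "b \<noteq> d"
  shows False
proof -
  have "a \<noteq> b" "b \<noteq> c" "c \<noteq> d" "d \<noteq> a" using assms no_loops' by blast+
  with assms show False
    by (intro forest_closed_list[of "[a, b, c, d]"]) auto
qed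

text \<open>A coincidence of two non-consecutive vertices would leave a triangle. A closed walk of
  length 4 may instead run back and forth along edges, hence the inequalities in
  \<open>forest_no_square\<close>.\<close>

lemma forest_no_pentagon:
  assumes "(a, b) \<in> parcs F" "(b, c) \<in> parcs F" "(c, d) \<in> parcs F" "(d, e) \<in> parcs F" "(e, a) \<in> parcs F"
  shows False
proof -
  have "a \<noteq> b" "b \<noteq> c" "c \<noteq> d" "d \<noteq> e" "e \<noteq> a" using assms no_loops' by blast+
  moreover have "a \<noteq> c" "b \<noteq> d" "c \<noteq> e" "d \<noteq> a" "e \<noteq> b" using assms forest_no_triangle by blast+
  ultimately show False using assms
    by (intro forest_closed_list[of "[a, b, c, d, e]"]) auto
qed

text \<open>
  Such a forest is a star, or a double star with a single leaf \<open>y\<close> at \<open>b\<close>, plus isolated vertices.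
  For \<open>a\<close> take a vertex of maximum degree. For a star, \<open>b = y = a\<close> serves as a dummy.
\<close>

lemma free_forest_structure:
  assumes no_2K2: "\<And>p q r s. (p, q) \<in> parcs F \<Longrightarrow> (r, s) \<in> parcs F \<Longrightarrow>
      (p, r) \<in> parcs F \<or> (p, s) \<in> parcs F \<or> (q, r) \<in> parcs F \<or> (q, s) \<in> parcs F"
    and no_D: "\<And>a b x x' y y'. distinct [a, b, x, x', y, y'] \<Longrightarrow>
      (a, b) \<in> parcs F \<Longrightarrow> (a, x) \<in> parcs F \<Longrightarrow> (a, x') \<in> parcs F \<Longrightarrow> (b, y) \<in> parcs F \<Longrightarrow> (b, y') \<in> parcs F \<Longrightarrow>
      False"
  obtains a b y where "\<And>u v. (u, v) \<in> parcs F \<Longrightarrow> u = a \<or> v = a \<or> {u, v} = {b, y}"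
    "(b, y) \<in> parcs F \<Longrightarrow> (a, b) \<in> parcs F" "(a, y) \<notin> parcs F"
proof (cases "parcs F = {}")
  case True
  then show ?thesis using that by blast
next
  case False
  define N where "N u = {v. (u, v) \<in> parcs F}" for u
  have finN: "finite (N u)" for u
    by (rule finite_subset[OF _ pair_finite_verts]) (auto simp: N_def dest: wellformed')
  have sym: "(u, v) \<in> parcs F \<longleftrightarrow> (v, u) \<in> parcs F" for u v using arcs_symmetric by blast
  note tri = forest_no_triangle and sq = forest_no_square and pent = forest_no_pentagon
  have "pverts F \<noteq> {}" using False by (auto dest: wellformed')
  then have "Max ((card \<circ> N) ` pverts F) \<in> (card \<circ> N) ` pverts F"
    using pair_finite_verts by (intro Max_in) auto
  then obtain a where a: "a \<in> pverts F" "card (N a) = Max ((card \<circ> N) ` pverts F)" by auto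
  have max: "card (N u) \<le> card (N a)" if "u \<in> pverts F" for u
    using that a(2) pair_finite_verts by auto
  \<comment> \<open>How maximality enters: \<open>a\<close> has at least as many neighbours as
    \<open>T\<close> has elements, so the smaller set \<open>S\<close> misses one of them.\<close>
  have deg: "\<exists>v. (a, v) \<in> parcs F \<and> v \<notin> S"
    if "finite S" "card S < card T" "T \<subseteq> N u" "u \<in> pverts F" for u S T
  proof -
    have "card S < card (N a)"
      using that(2) card_mono[OF finN that(3)] max[OF that(4)] by linarith
    then have "\<not> N a \<subseteq> S"
      using card_mono[OF that(1), of "N a"] by linarith
    then show ?thesis by (auto simp: N_def)
  qed
  \<comment> \<open>Otherwise every neighbour of \<open>a\<close> is joined to an end of the edge,
    as there is no induced \<open>two_K2\<close>. If \<open>x\<close> is joined to the end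
    \<open>c\<close>, then \<open>c\<close> has degree at least 2, so \<open>a\<close> has a second
    neighbour \<open>x'\<close>; joining it to \<open>c\<close> or to the other end \<open>d\<close>
    closes a cycle of length 4 or 5.\<close>
  have edge: "(a, b) \<in> parcs F \<or> (a, y) \<in> parcs F" if bc: "(b, y) \<in> parcs F" "b \<noteq> a" "y \<noteq> a" for b y
  proof (rule ccontr)
    assume n: "\<not> ((a, b) \<in> parcs F \<or> (a, y) \<in> parcs F)"
    obtain x where x: "(a, x) \<in> parcs F"
      using deg[of "{}" "{y}" b] bc(1) by (auto simp: N_def dest: wellformed')
    then have "x \<noteq> b" "x \<noteq> y" using n by auto
    with no_2K2[OF x bc(1)] n have "(x, b) \<in> parcs F \<or> (x, y) \<in> parcs F" by blast
    then obtain c d where cd: "{c, d} = {b, y}" "(x, c) \<in> parcs F" by blast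
    then have cd': "(c, d) \<in> parcs F" "c \<noteq> a" "d \<noteq> a" "(a, c) \<notin> parcs F" "(a, d) \<notin> parcs F"
      using bc n sym by (auto simp: doubleton_eq_iff)
    have "x \<noteq> d" using cd(1) \<open>x \<noteq> b\<close> \<open>x \<noteq> y\<close> by (auto simp: doubleton_eq_iff)
    moreover have "{x, d} \<subseteq> N c" "c \<in> pverts F"
      using cd cd' sym by (auto simp: N_def dest: wellformed')
    ultimately obtain x' where x': "(a, x') \<in> parcs F" "x' \<noteq> x"
      using deg[of "{x}" "{x, d}" c] by auto
    with no_2K2[OF x'(1) cd'(1)] cd' have "(x', c) \<in> parcs F \<or> (x', d) \<in> parcs F" by blast
    then show False
      using sq[of a x c x'] pent[of a x c d x'] x x' cd cd' sym by blast
  qed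
  show ?thesis
  proof (cases "\<exists>b y. (b, y) \<in> parcs F \<and> b \<noteq> a \<and> y \<noteq> a")
    case False
    have "(a, a) \<notin> parcs F" using no_loops' by blast
    then show ?thesis using False that[of a a a] by blast
  next
    case True
    then obtain b y where "(b, y) \<in> parcs F" "b \<noteq> a" "y \<noteq> a" "(a, b) \<in> parcs F"
      using edge sym by metis
    note bc = this
    have unique: "c = b \<and> z = y" if cz: "(c, z) \<in> parcs F" "c \<noteq> a" "z \<noteq> a" "(a, c) \<in> parcs F" for c z
    proof -
      \<comment> \<open>If \<open>c\<close> and \<open>b\<close> differ, any edge between
        \<open>by\<close> and \<open>cz\<close> closes a cycle of length 3, 4 or 5 through
        \<open>a\<close>, so these edges contradict \<open>no_2K2\<close>.\<close>
      have "c = b"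
      proof (rule ccontr)
        assume "c \<noteq> b"
        have "z \<noteq> y" using sq[of a b y c] bc cz \<open>c \<noteq> b\<close> sym by blast
        have "(b, c) \<notin> parcs F" using tri[of a b c] bc cz sym by blast
        moreover have "(b, z) \<notin> parcs F" using sq[of a b z c] bc cz \<open>c \<noteq> b\<close> sym by blast
        moreover have "(y, c) \<notin> parcs F" using sq[of a b y c] bc cz \<open>c \<noteq> b\<close> sym by blast
        moreover have "(y, z) \<notin> parcs F" using pent[of a b y z c] bc cz sym by blast
        ultimately show False using no_2K2[OF bc(1) cz(1)] by blast
      qed
      \<comment> \<open>If \<open>z\<close> and \<open>y\<close> differ, \<open>b\<close> has the
        three neighbours \<open>a\<close>, \<open>y\<close>, \<open>z\<close>. By the choice of
        \<open>a\<close>, it has two neighbours besides \<open>b\<close>, which gives the double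
        star excluded by \<open>no_D\<close>.\<close>
      moreover have "z = y"
      proof (rule ccontr)
        assume "z \<noteq> y"
        \<comment> \<open>This keeps \<open>y\<close> and \<open>z\<close> apart from the neighbours
          \<open>x\<close> and \<open>x'\<close> of \<open>a\<close> chosen below.\<close>
        have nay: "(a, y) \<notin> parcs F" "(a, z) \<notin> parcs F"
          using tri[of a b y] tri[of a b z] bc cz \<open>c = b\<close> sym by blast+
        have N_b: "{a, y, z} \<subseteq> N b" "b \<in> pverts F"
          using bc cz \<open>c = b\<close> sym by (auto simp: N_def dest: wellformed')
        have c3: "card {a, y, z} = 3" using bc cz \<open>z \<noteq> y\<close> by simp
        obtain x where x: "(a, x) \<in> parcs F" "x \<noteq> b"
          using deg[OF _ _ N_b, of "{b}"] c3 by auto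
        obtain x' where x': "(a, x') \<in> parcs F" "x' \<noteq> b" "x' \<noteq> x"
          using deg[OF _ _ N_b, of "{b, x}"] c3 x(2) by auto
        show False
          using no_D[of a b x x' y z] x x' bc cz \<open>c = b\<close> \<open>z \<noteq> y\<close> nay no_loops' by auto
      qed
      ultimately show ?thesis by simp
    qed
    have "(a, y) \<notin> parcs F" using tri[of a b y] bc sym by blast
    \<comment> \<open>By \<open>edge\<close> one end is adjacent to \<open>a\<close>;
      \<open>unique\<close> applies in the orientation starting there.\<close>
    moreover have "u = a \<or> v = a \<or> {u, v} = {b, y}" if "(u, v) \<in> parcs F" for u v
      using that edge[OF that] unique[of u v] unique[of v u] sym by blast
    ultimately show ?thesis using that[of a b y] bc by blast
  qed
qed

end

section \<open>The equivalence for forests\<close>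

theorem corollary4:
  fixes F :: "'a pair_pre_digraph"
  assumes "forest_graph F"
  shows "acyclic_graph (TS 2 F) \<longleftrightarrow> induced_free {two_K2, D_graph 2 2 2} F"
proof
  interpret pair_graph F using assms by (simp add: forest_graph_def)
  have free_iff: "induced_free {two_K2, D_graph 2 2 2} F \<longleftrightarrow>
      \<not> (\<exists>S. induced_subgraph S (with_proj F) \<and> digraph_iso S (with_proj two_K2)) \<and>
      \<not> (\<exists>S. induced_subgraph S (with_proj F) \<and> digraph_iso S (with_proj (D_graph 2 2 2)))"
    by (auto simp: induced_free_def)
  {
    assume "acyclic_graph (TS 2 F)"
    then show "induced_free {two_K2, D_graph 2 2 2} F"
      unfolding free_iff two_K2_copy_iff[OF pair_graph] D_graph_2_2_2_copy_iff[OF pair_graph]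
      using not_acyclic_TS_2_if_two_K2 not_acyclic_TS_2_if_double_star by blast
  next
    assume free: "induced_free {two_K2, D_graph 2 2 2} F"
    have sym: "(u, v) \<in> parcs F \<longleftrightarrow> (v, u) \<in> parcs F" for u v using arcs_symmetric by blast
    note tri = forest_no_triangle[OF assms] and sq = forest_no_square[OF assms]
    have no_2K2: "(p, r) \<in> parcs F \<or> (p, s) \<in> parcs F \<or> (q, r) \<in> parcs F \<or> (q, s) \<in> parcs F"
      if "(p, q) \<in> parcs F" "(r, s) \<in> parcs F" for p q r s
      using free that unfolding free_iff two_K2_copy_iff[OF pair_graph] by blast
    \<comment> \<open>In a forest the five edges already force an induced copy, since any further
      edge among the six vertices closes a cycle of length 3 or 4.\<close>
    have no_D: False
      if d: "distinct [a, b, x, x', y, y']"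
        and e: "(a, b) \<in> parcs F" "(a, x) \<in> parcs F" "(a, x') \<in> parcs F" "(b, y) \<in> parcs F" "(b, y') \<in> parcs F"
      for a b x x' y y'
    proof -
      have e': "(b, a) \<in> parcs F" "(x, a) \<in> parcs F" "(x', a) \<in> parcs F" "(y, b) \<in> parcs F" "(y', b) \<in> parcs F"
        using e sym by blast+
      have "(a, y) \<notin> parcs F" "(a, y') \<notin> parcs F" "(b, x) \<notin> parcs F" "(b, x') \<notin> parcs F"
        "(x, x') \<notin> parcs F" "(y, y') \<notin> parcs F"
        using e e' tri by blast+
      moreover have "(x, y) \<notin> parcs F" "(x, y') \<notin> parcs F" "(x', y) \<notin> parcs F" "(x', y') \<notin> parcs F"
        using sq[of a x y b] sq[of a x y' b] sq[of a x' y b] sq[of a x' y' b] e e' d by auto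
      ultimately show False
        using free d e unfolding free_iff D_graph_2_2_2_copy_iff[OF pair_graph] by blast
    qed
    show "acyclic_graph (TS 2 F)"
    proof (rule free_forest_structure[OF assms])
      fix a b y
      assume "\<And>u v. (u, v) \<in> parcs F \<Longrightarrow> u = a \<or> v = a \<or> {u, v} = {b, y}"
        "(b, y) \<in> parcs F \<Longrightarrow> (a, b) \<in> parcs F" "(a, y) \<notin> parcs F"
      then show ?thesis by (rule acyclic_TS_2I)
    qed (erule (1) no_2K2, rule no_D)
  }
qed

end
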